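(* Let $X\subseteq\mathbb{R}^m$, let $f=(f_1,\dots,f_d)$ with $f_i:\mathbb{R}^m\to\mathbb{R}$, and let $f^L,f^U\in\mathbb{R}^d$ satisfy $f^L\le f(x)\le f^U$ for all $x\in X$. Let $n\ge 1$ and let $u_{ij},a_{ij}:\mathbb{R}^m\to\mathbb{R}$ ($1\le i\le d$, $0\le j\le n$) be functions such that for all $x\in X$ and all $i\in\{1,\dots,d\}$: $f_i^L\le a_{i0}(x)\le a_{i1}(x)\le\cdots\le a_{in}(x)\le f_i^U$; $u_{ij}(x)\le\min\{f_i(x),a_{ij}(x)\}$ for all $j\in\{0,\dots,n\}$; $u_{i0}(x)=a_{i0}(x)$; and $u_{in}(x)=f_i(x)$. If $\phi:\mathbb{R}^d\to\mathbb{R}$ is supermodular over $[f^L,f^U]$, then for every direction vector $\omega$ in the grid $\{0,\dots,n\}^d$ and every $x\in X$, $$\phi(f(x))\le \mathcal{B}^\omega(\phi)\bigl(u(x),a(x)\bigr).$$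
   Context: $[f^L,f^U]=\prod_{i=1}^d[f^L_i,f^U_i]$. A function $\eta:S\subseteq\mathbb{R}^d\to\mathbb{R}$ ($S$ closed under componentwise max $\vee$ and min $\wedge$) is supermodular if $\eta(x'\vee x'')+\eta(x'\wedge x'')\ge\eta(x')+\eta(x'')$ for all $x',x''\in S$; "supermodular over $[f^L,f^U]$" means its restriction to this box is supermodular. A direction vector in the grid $\{0,\dots,n\}^d$ is $\omega=(\omega_1,\dots,\omega_{dn})\in\{1,\dots,d\}^{dn}$ in which each $i\in\{1,\dots,d\}$ occurs exactly $n$ times. It defines the staircase $p^0=(0,\dots,0)$, $p^t=p^{t-1}+e_{\omega_t}$ for $t=1,\dots,dn$, where $e_i$ is the $i$-th unit vector of $\mathbb{R}^d$ (so $p^{dn}=(n,\dots,n)$). For $v=(v_1,\dots,v_d)\in\mathbb{R}^{d\times(n+1)}$ with $v_i=(v_{i0},\dots,v_{in})$ and $p\in\{0,\dots,n\}^d$, put $\Pi(v;p)=(v_{1p_1},\dots,v_{dp_d})\in\mathbb{R}^d$. For $u,a\in\mathbb{R}^{d\times(n+1)}$, $(a_{-i},u_i)$ denotes $(a_1,\dots,a_{i-1},u_i,a_{i+1},\dots,a_d)$. Define $$\mathcal{B}^\omega(\phi)(u,a)=\phi(a_{10},\dots,a_{d0})+\sum_{t=1}^{dn}\Bigl[\phi\bigl(\Pi((a_{-\omega_t},u_{\omega_t});p^t)\bigr)-\phi\bigl(\Pi((a_{-\omega_t},u_{\omega_t});p^{t-1})\bigr)\Bigr].$$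
   Formalization: The formal theorem additionally assumes f_i^L ≤ u_ij(x) for all x in X, all i and all 0 ≤ j ≤ n; without it φ may be evaluated outside [f^L,f^U], where it is arbitrary, and the inequality can fail (e.g. d=n=2). *)

theory Defs
  imports "HOL-Analysis.Analysis"
begin

(* Coordinates of R^d are indexed by a finite type 'd (d = CARD('d)); on real^'d the library
   operations sup, inf and the order are componentwise.  A point v of R^(d x (n+1)) is
   represented by a function 'd => nat => real of which only the values v i 0, ..., v i n
   are used. *)

(* Intended for sets S closed under sup and inf, such as the boxes {l..u}. *)
definition supermodular_on :: "(real ^ 'd) set \<Rightarrow> (real ^ 'd \<Rightarrow> real) \<Rightarrow> bool" where
  "supermodular_on S \<eta> \<longleftrightarrow>
     (\<forall>x'\<in>S. \<forall>x''\<in>S. \<eta> (sup x' x'') + \<eta> (inf x' x'') \<ge> \<eta> x' + \<eta> x'')"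

(* Lists are indexed from 0, so the t-th entry of a direction vector is \<omega> ! (t - 1). *)
definition direction_vector :: "nat \<Rightarrow> 'd::finite list \<Rightarrow> bool" where
  "direction_vector n \<omega> \<longleftrightarrow>
     length \<omega> = CARD('d) * n \<and> (\<forall>i. count_list \<omega> i = n)"

primrec staircase :: "'d::finite list \<Rightarrow> nat \<Rightarrow> nat ^ 'd" where
  "staircase \<omega> 0 = 0"
| "staircase \<omega> (Suc t) = staircase \<omega> t + axis (\<omega> ! t) 1"

definition grid_proj :: "('d::finite \<Rightarrow> nat \<Rightarrow> real) \<Rightarrow> nat ^ 'd \<Rightarrow> real ^ 'd" where
  "grid_proj v p = (\<chi> i. v i (p $ i))"

(* a(i := u i) is (a_{-i}, u_i).  For a direction vector in {0..n}^d, length \<omega> is d n. *)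
definition staircase_bound ::
  "'d::finite list \<Rightarrow> (real ^ 'd \<Rightarrow> real) \<Rightarrow> ('d \<Rightarrow> nat \<Rightarrow> real) \<Rightarrow> ('d \<Rightarrow> nat \<Rightarrow> real) \<Rightarrow> real" where
  "staircase_bound \<omega> \<phi> u a =
     \<phi> (\<chi> i. a i 0) +
     (\<Sum>t = 1..length \<omega>.
        \<phi> (grid_proj (a(\<omega> ! (t - 1) := u (\<omega> ! (t - 1)))) (staircase \<omega> t)) -
        \<phi> (grid_proj (a(\<omega> ! (t - 1) := u (\<omega> ! (t - 1)))) (staircase \<omega> (t - 1))))"

(* The staircase inequality
     \<phi> (f x) <= staircase_bound \<omega> \<phi> (\<lambda>i j. u i j x) (\<lambda>i j. a i j x)
   for \<phi> supermodular on {fL..fU} needs fL $ i <= u i j x also for 0 < j < n (for j = 0 and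
   j = n it follows from u i 0 x = a i 0 x and u i n x = f x $ i): otherwise \<phi> is evaluated
   outside the box, where it is arbitrary.  Counterexample without this bound: d = n = 2,
   box [0,1]^2, f x = (1,1), a_1 = a_2 = u_2 = (0,1,1), u_1 = (0,-1,1), \<omega> = (1,2,1,2),
   \<phi> (-1,0) = -1 and \<phi> = 0 elsewhere; then \<phi> (f x) = 0 and the bound is -1. *)

end

theory Submission
  imports Defs
begin

text \<open>
  Replace each row \<open>u i\<close> by its running maximum \<open>s i\<close>, which still lies between \<open>u i\<close> and \<open>a i\<close>,
  has the same first and last entries, and is nondecreasing. Walking along the staircase, the invariant is
  that \<open>\<phi>\<close> at the current point of \<open>s\<close> is at most the partial staircase sum plus, for each \<open>i\<close>, the correction
  \<open>\<phi> (a\<^bsub>-i\<^esub>, s\<^bsub>i\<^esub>) - \<phi> (a\<^bsub>-i\<^esub>, u\<^bsub>i\<^esub>)\<close> at the current grid point. A step in direction \<open>i\<close> does not decrease the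
  corrections for \<open>k \<noteq> i\<close> (increasing differences of \<open>\<phi>\<close>), and together with the correction for \<open>i\<close> the new
  summand contributes an increment of \<open>\<phi> (a\<^bsub>-i\<^esub>, s\<^bsub>i\<^esub>)\<close>, which dominates that of \<open>\<phi> (s\<^bsub>-i\<^esub>, s\<^bsub>i\<^esub>)\<close>. All
  corrections vanish at both ends of the staircase.
\<close>

text \<open>The hypotheses make \<open>y2\<close> the join and \<open>x1\<close> the meet of
  \<open>x2\<close> and \<open>y1\<close>, so this is the supermodular inequality for that pair,
  rearranged. Passing from \<open>x\<close> to \<open>y\<close> raises coordinates other than
  \<open>i\<close>; passing from index 1 to 2 raises coordinate \<open>i\<close>.\<close>

lemma supermodular_on_increasing_differences:
  fixes x1 x2 y1 y2 l h :: "real ^ 'd"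
  assumes "supermodular_on {l..h} \<phi>"
    and "x2 \<in> {l..h}" and "y1 \<in> {l..h}"
    and off: "\<And>k. k \<noteq> i \<Longrightarrow> x2 $ k = x1 $ k \<and> y2 $ k = y1 $ k \<and> x1 $ k \<le> y1 $ k"
    and at: "x1 $ i = y1 $ i" "x2 $ i = y2 $ i" "x1 $ i \<le> x2 $ i"
  shows "\<phi> x2 - \<phi> x1 \<le> \<phi> y2 - \<phi> y1"
proof -
  have "sup x2 y1 $ k = y2 $ k \<and> inf x2 y1 $ k = x1 $ k" for k
    using off[of k] at by (cases "k = i") (auto simp: sup_vec_def inf_vec_def sup_real_def inf_real_def)
  then have "sup x2 y1 = y2" "inf x2 y1 = x1"
    by (simp_all add: vec_eq_iff)
  then show ?thesis
    using assms(1-3) unfolding supermodular_on_def by fastforce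
qed

lemma grid_proj_in_box:
  fixes l h :: "real ^ 'd::finite"
  assumes "\<And>i. l $ i \<le> v i (p $ i) \<and> v i (p $ i) \<le> h $ i"
  shows "grid_proj v p \<in> {l..h}"
  using assms by (simp add: grid_proj_def less_eq_vec_def)

lemma staircase_eq_count_list:
  assumes "t \<le> length \<omega>"
  shows "staircase \<omega> t $ i = count_list (take t \<omega>) i"
  using assms by (induction t) (auto simp: axis_def take_Suc_conv_app_nth)

lemma count_list_take_le: "count_list (take t xs) y \<le> count_list xs y"
proof -
  have "count_list xs y = count_list (take t xs @ drop t xs) y"
    by simp
  then show ?thesis
    by (simp only: count_list_append le_add1)
qed

lemma staircase_le:
  assumes "t \<le> length \<omega>"
  shows "staircase \<omega> t $ i \<le> count_list \<omega> i"
  using assms by (simp add: staircase_eq_count_list count_list_take_le)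

lemma staircase_partial_sum_bound:
  fixes \<omega> :: "'d::finite list" and l h :: "real ^ 'd" and u s a :: "'d \<Rightarrow> nat \<Rightarrow> real"
  assumes super: "supermodular_on {l..h} \<phi>"
    and count: "\<And>i. count_list \<omega> i \<le> n"
    and a_mono: "\<And>i. mono_on {..n} (a i)" and s_mono: "\<And>i. mono_on {..n} (s i)"
    and first: "\<And>i. u i 0 = a i 0" "\<And>i. s i 0 = a i 0"
    and order: "\<And>i j. j \<le> n \<Longrightarrow> l $ i \<le> u i j \<and> u i j \<le> s i j \<and> s i j \<le> a i j \<and> a i j \<le> h $ i"
    and "t \<le> length \<omega>"
  shows "\<phi> (grid_proj s (staircase \<omega> t)) \<le>
    \<phi> (\<chi> i. a i 0) +
    (\<Sum>r = 1..t.
       \<phi> (grid_proj (a(\<omega> ! (r - 1) := u (\<omega> ! (r - 1)))) (staircase \<omega> r)) -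
       \<phi> (grid_proj (a(\<omega> ! (r - 1) := u (\<omega> ! (r - 1)))) (staircase \<omega> (r - 1)))) +
    (\<Sum>i\<in>UNIV. \<phi> (grid_proj (a(i := s i)) (staircase \<omega> t)) -
       \<phi> (grid_proj (a(i := u i)) (staircase \<omega> t)))"
  using \<open>t \<le> length \<omega>\<close>
proof (induction t)
  case 0
  \<comment> \<open>Moving the column index inside the update lets \<open>first\<close> rewrite both
    branches, so every correction vanishes at the origin.\<close>
  have "a(i := u i) = (\<lambda>k j. if k = i then u i j else a k j)"
    "a(i := s i) = (\<lambda>k j. if k = i then s i j else a k j)" for i
    by auto
  then have "grid_proj (a(i := s i)) 0 = grid_proj (a(i := u i)) 0" for i
    by (simp add: grid_proj_def vec_eq_iff first)
  then show ?case
    by (simp add: grid_proj_def first)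
next
  case (Suc t)
  let ?p = "staircase \<omega> t" and ?q = "staircase \<omega> (Suc t)" and ?i = "\<omega> ! t"
  let ?c = "\<lambda>p k. \<phi> (grid_proj (a(k := s k)) p) - \<phi> (grid_proj (a(k := u k)) p)"
  let ?d = "\<lambda>r. \<phi> (grid_proj (a(\<omega> ! (r - 1) := u (\<omega> ! (r - 1)))) (staircase \<omega> r)) -
    \<phi> (grid_proj (a(\<omega> ! (r - 1) := u (\<omega> ! (r - 1)))) (staircase \<omega> (r - 1)))"
  have q: "?q $ k = (if k = ?i then Suc (?p $ k) else ?p $ k)" for k
    by (simp add: axis_def)
  have pn: "?p $ k \<le> n" and qn: "?q $ k \<le> n" for k
    using staircase_le[of t \<omega> k] staircase_le[of "Suc t" \<omega> k] count[of k] Suc.prems by linarith+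
  have pq: "?p $ k \<le> ?q $ k" for k
    unfolding q by simp
  have a_pq: "a k (?p $ k) \<le> a k (?q $ k)" and s_pq: "s k (?p $ k) \<le> s k (?q $ k)" for k
    using mono_onD[OF a_mono _ _ pq] mono_onD[OF s_mono _ _ pq] pn qn by auto
  have box_p: "l $ k \<le> u k (?p $ k) \<and> u k (?p $ k) \<le> s k (?p $ k) \<and>
      s k (?p $ k) \<le> a k (?p $ k) \<and> a k (?p $ k) \<le> h $ k"
    and box_q: "l $ k \<le> u k (?q $ k) \<and> u k (?q $ k) \<le> s k (?q $ k) \<and>
      s k (?q $ k) \<le> a k (?q $ k) \<and> a k (?q $ k) \<le> h $ k" for k
    using order pn qn by blast+
  have box_p': "l $ k \<le> s k (?p $ k)" "l $ k \<le> a k (?p $ k)" "u k (?p $ k) \<le> h $ k" "s k (?p $ k) \<le> h $ k"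
    and box_q': "l $ k \<le> s k (?q $ k)" "l $ k \<le> a k (?q $ k)" "u k (?q $ k) \<le> h $ k" "s k (?q $ k) \<le> h $ k" for k
    using box_p[of k] box_q[of k] by linarith+
  \<comment> \<open>Coordinate \<open>k\<close> stays put in this step, so going from
    \<open>u k\<close> to \<open>s k\<close> raises only that coordinate, while going from
    \<open>?p\<close> to \<open>?q\<close> raises coordinate \<open>?i\<close> of the surrounding
    \<open>a\<close>.\<close>
  have other: "?c ?p k \<le> ?c ?q k" if "k \<noteq> ?i" for k
  proof (rule supermodular_on_increasing_differences[OF super, where i = k])
    have "?q $ k = ?p $ k"
      using q that by simp
    then show "grid_proj (a(k := u k)) ?p $ k = grid_proj (a(k := u k)) ?q $ k"
      "grid_proj (a(k := s k)) ?p $ k = grid_proj (a(k := s k)) ?q $ k"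
      by (simp_all only: grid_proj_def vec_lambda_beta fun_upd_same)
  qed (use box_p box_q box_p' box_q' a_pq in
        \<open>auto simp: grid_proj_def less_eq_vec_def simp del: staircase.simps\<close>)
  have split: "(\<Sum>k\<in>UNIV. ?c p k) = ?c p ?i + (\<Sum>k\<in>UNIV - {?i}. ?c p k)" for p
    by (simp add: sum.remove)
  \<comment> \<open>Here the step itself is the move in coordinate \<open>?i\<close>, and replacing
    \<open>s\<close> by \<open>a\<close> raises the others. The move must be upward, which is where
    monotonicity of \<open>s\<close> enters; \<open>u\<close> need not be monotone.\<close>
  have "\<phi> (grid_proj s ?q) - \<phi> (grid_proj s ?p) \<le>
      \<phi> (grid_proj (a(?i := s ?i)) ?q) - \<phi> (grid_proj (a(?i := s ?i)) ?p)"
  proof (rule supermodular_on_increasing_differences[OF super, where i = ?i])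
    fix k assume "k \<noteq> ?i"
    then have "?q $ k = ?p $ k"
      using q by simp
    then show "grid_proj s ?q $ k = grid_proj s ?p $ k \<and>
        grid_proj (a(?i := s ?i)) ?q $ k = grid_proj (a(?i := s ?i)) ?p $ k \<and>
        grid_proj s ?p $ k \<le> grid_proj (a(?i := s ?i)) ?p $ k"
      using box_p[of k] \<open>k \<noteq> ?i\<close> by (simp del: staircase.simps add: grid_proj_def)
  qed (use box_p box_q box_p' box_q' s_pq in
        \<open>auto simp: grid_proj_def less_eq_vec_def simp del: staircase.simps\<close>)
  moreover have "(\<Sum>k\<in>UNIV - {?i}. ?c ?p k) \<le> (\<Sum>k\<in>UNIV - {?i}. ?c ?q k)"
    by (rule sum_mono) (use other in blast)
  moreover have "(\<Sum>r = 1..Suc t. ?d r) = (\<Sum>r = 1..t. ?d r) + ?d (Suc t)"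
    by simp
  \<comment> \<open>These two terms cancel the \<open>u\<close>-terms in
    \<open>?c ?q ?i - ?c ?p ?i\<close>, leaving exactly the increment that bounds the one of
    \<open>s\<close>.\<close>
  moreover have "?d (Suc t) = \<phi> (grid_proj (a(?i := u ?i)) ?q) - \<phi> (grid_proj (a(?i := u ?i)) ?p)"
    by (simp only: diff_Suc_1)
  moreover note split[of ?p] split[of ?q] Suc.IH[OF Suc_leD[OF Suc.prems]]
  ultimately show ?case
    by linarith
qed

text \<open>This is the inequality at one fixed \<open>x\<close>, with \<open>z\<close> in the role
  of \<open>f x\<close>.\<close>

lemma staircase_bound_ge:
  fixes \<omega> :: "'d::finite list" and l h z :: "real ^ 'd" and u a :: "'d \<Rightarrow> nat \<Rightarrow> real"
  assumes super: "supermodular_on {l..h} \<phi>"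
    and \<omega>: "direction_vector n \<omega>"
    and a_mono: "\<And>i. mono_on {..n} (a i)"
    and box: "\<And>i j. j \<le> n \<Longrightarrow> l $ i \<le> u i j \<and> a i j \<le> h $ i"
    and upper: "\<And>i j. j \<le> n \<Longrightarrow> u i j \<le> z $ i \<and> u i j \<le> a i j"
    and first: "\<And>i. u i 0 = a i 0" and last: "\<And>i. u i n = z $ i"
  shows "\<phi> z \<le> staircase_bound \<omega> \<phi> u a"
proof -
  define s where "s i j = Max (u i ` {..j})" for i j
  have "mono_on {..n} (s i)" for i
    unfolding s_def by (intro mono_onI Max_mono) auto
  moreover have u_le_s: "u i j \<le> s i j" for i j
    unfolding s_def by simp
  moreover have "s i j \<le> a i j" if "j \<le> n" for i j
  proof -
    \<comment> \<open>Since \<open>u i k \<le> a i k \<le> a i j\<close>, no earlier entry of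
      \<open>u i\<close> can push the running maximum above \<open>a i\<close>.\<close>
    have "u i k \<le> a i j" if "k \<le> j" for k
      using upper[of k i] mono_onD[OF a_mono[of i], of k j] that \<open>j \<le> n\<close> by force
    then show ?thesis
      unfolding s_def by auto
  qed
  moreover have s_0: "s i 0 = a i 0" for i
    unfolding s_def using first by simp
  \<comment> \<open>All entries of \<open>u i\<close> are at most \<open>z $ i\<close>, and the last
    one attains it.\<close>
  moreover have s_n: "s i n = z $ i" for i
  proof (rule antisym)
    show "s i n \<le> z $ i"
      unfolding s_def using upper by auto
    show "z $ i \<le> s i n"
      using u_le_s[of i n] last by simp
  qed
  moreover have counts: "count_list \<omega> i = n" for i
    using \<omega> by (simp add: direction_vector_def)
  ultimately have bound: "\<phi> (grid_proj s (staircase \<omega> (length \<omega>))) \<le>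
      staircase_bound \<omega> \<phi> u a +
      (\<Sum>i\<in>UNIV. \<phi> (grid_proj (a(i := s i)) (staircase \<omega> (length \<omega>))) -
        \<phi> (grid_proj (a(i := u i)) (staircase \<omega> (length \<omega>))))"
    unfolding staircase_bound_def
    by (intro staircase_partial_sum_bound[OF super, where n = n]) (use a_mono first box in auto)
  \<comment> \<open>At the corner \<open>(n,...,n)\<close> the rows \<open>s i\<close> and
    \<open>u i\<close> both end in \<open>z $ i\<close>, so \<open>s\<close> is read off as
    \<open>z\<close> and all corrections vanish.\<close>
  have top: "staircase \<omega> (length \<omega>) $ i = n" for i
    by (simp add: staircase_eq_count_list counts)
  have "grid_proj s (staircase \<omega> (length \<omega>)) = z"
    by (simp add: grid_proj_def vec_eq_iff top s_n)
  moreover have "grid_proj (a(i := s i)) (staircase \<omega> (length \<omega>)) =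
      grid_proj (a(i := u i)) (staircase \<omega> (length \<omega>))" for i
    by (simp add: grid_proj_def vec_eq_iff top s_n last)
  ultimately show ?thesis
    using bound by simp
qed

theorem theorem2p1:
  fixes X :: "(real ^ 'm) set"
    and f :: "real ^ 'm \<Rightarrow> real ^ 'd"
    and fL fU :: "real ^ 'd"
    and n :: nat
    and u a :: "'d \<Rightarrow> nat \<Rightarrow> real ^ 'm \<Rightarrow> real"
    and \<phi> :: "real ^ 'd \<Rightarrow> real"
  assumes f_bounds: "\<forall>x\<in>X. fL \<le> f x \<and> f x \<le> fU"
    and n_ge_1: "n \<ge> 1"
    and a_chain: "\<forall>x\<in>X. \<forall>i. fL $ i \<le> a i 0 x \<and> (\<forall>j<n. a i j x \<le> a i (Suc j) x) \<and> a i n x \<le> fU $ i"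
    and u_upper: "\<forall>x\<in>X. \<forall>i. \<forall>j\<in>{0..n}. u i j x \<le> min (f x $ i) (a i j x)"
    and u_first: "\<forall>x\<in>X. \<forall>i. u i 0 x = a i 0 x"
    and u_last: "\<forall>x\<in>X. \<forall>i. u i n x = f x $ i"
    and u_in_box: "\<forall>x\<in>X. \<forall>i. \<forall>j\<in>{0..n}. fL $ i \<le> u i j x"
    and supermod: "supermodular_on {fL..fU} \<phi>"
  shows "\<forall>\<omega>. direction_vector n \<omega> \<longrightarrow>
           (\<forall>x\<in>X. \<phi> (f x) \<le> staircase_bound \<omega> \<phi> (\<lambda>i j. u i j x) (\<lambda>i j. a i j x))"
proof (intro allI impI ballI)
  fix \<omega> :: "'d list" and x
  assume \<omega>: "direction_vector n \<omega>" and x: "x \<in> X"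
  have a_mono: "mono_on {..n} (\<lambda>j. a i j x)" for i
  proof (rule mono_onI)
    fix j k assume "j \<in> {..n}" "k \<in> {..n}" "j \<le> k"
    from \<open>j \<le> k\<close> \<open>k \<in> {..n}\<close> show "a i j x \<le> a i k x"
    proof (induction k rule: dec_induct)
      case (step k)
      then have "a i k x \<le> a i (Suc k) x"
        using a_chain x by simp
      with step show ?case
        by simp
    qed simp
  qed
  have a_upper: "a i j x \<le> fU $ i" if "j \<le> n" for i j
    using mono_onD[OF a_mono[of i], of j n] a_chain x that by force
  show "\<phi> (f x) \<le> staircase_bound \<omega> \<phi> (\<lambda>i j. u i j x) (\<lambda>i j. a i j x)"
    by (rule staircase_bound_ge[OF supermod \<omega> a_mono])
      (use x a_upper u_upper u_first u_last u_in_box in auto)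
qed

end
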